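(* Let $G$ be a connected graph with $p$ vertices and $q$ edges such that $e(v_i)>1$ for every vertex $v_i$. Then $$W_\epsilon(G)\leq\frac{(p-1)\varepsilon^*(G)-\zeta(G)}{2},$$ with equality if and only if $\operatorname{diam}(G)=2$.
   Context: Graphs are finite, simple, undirected. For a connected graph $G$ with vertices $v_1,\ldots,v_p$, $d(v_i,v_j)$ is the distance, $e(v_i)=\max_j d(v_i,v_j)$ the eccentricity, and $\deg(v_i)$ the degree. The eccentricity matrix $\epsilon(G)$ has $(i,j)$ entry $d(v_i,v_j)$ if $d(v_i,v_j)=\min\{e(v_i),e(v_j)\}$ and $0$ otherwise. $W_\epsilon(G)=\frac12\sum_{i,j}(\epsilon(G))_{ij}$; $\varepsilon^*(G)=\sum_i e(v_i)$ is the total eccentricity; $\zeta(G)=\sum_i\deg(v_i)e(v_i)$ is the eccentric connectivity index. *)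

theory Defs
  imports "Graph_Theory.Graph_Theory"
begin

text \<open>
  A finite simple undirected graph is a term \<open>G\<close> with \<open>graph G\<close>: a finite symmetric digraph
  without loops and without parallel arcs.  Every undirected edge thus consists of two opposite
  arcs, and the degree of a vertex, its number of neighbours, is its out-degree.
\<close>

definition uedges :: "('a, 'b) pre_digraph \<Rightarrow> 'a set set" where
  "uedges G = (\<lambda>a. {tail G a, head G a}) ` arcs G"

definition deg :: "('a, 'b) pre_digraph \<Rightarrow> 'a \<Rightarrow> nat" where
  "deg G v = out_degree G v"

text \<open>
  The unit-cost shortest path distance. The extended real is finite when \<open>v\<close> is reachable
  from \<open>u\<close>; on a connected graph nothing is lost in the conversion
  (see \<open>gdist_eq_Least\<close> below).
\<close>

definition gdist :: "('a, 'b) pre_digraph \<Rightarrow> 'a \<Rightarrow> 'a \<Rightarrow> real" where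
  "gdist G u v = real_of_ereal (wf_digraph.\<mu> G (\<lambda>_. 1) u v)"

definition ecc :: "('a, 'b) pre_digraph \<Rightarrow> 'a \<Rightarrow> real" where
  "ecc G u = Max (gdist G u ` verts G)"

definition diam :: "('a, 'b) pre_digraph \<Rightarrow> real" where
  "diam G = Max (ecc G ` verts G)"

text \<open>The eccentricity matrix, with rows and columns indexed by the vertices themselves.\<close>

definition ecc_matrix :: "('a, 'b) pre_digraph \<Rightarrow> 'a \<Rightarrow> 'a \<Rightarrow> real" where
  "ecc_matrix G u v = (if gdist G u v = min (ecc G u) (ecc G v) then gdist G u v else 0)"

definition ecc_wiener :: "('a, 'b) pre_digraph \<Rightarrow> real" where
  "ecc_wiener G = 1 / 2 * (\<Sum>u\<in>verts G. \<Sum>v\<in>verts G. ecc_matrix G u v)"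

definition total_ecc :: "('a, 'b) pre_digraph \<Rightarrow> real" where
  "total_ecc G = (\<Sum>v\<in>verts G. ecc G v)"

definition ecc_connectivity :: "('a, 'b) pre_digraph \<Rightarrow> real" where
  "ecc_connectivity G = (\<Sum>v\<in>verts G. real (deg G v) * ecc G v)"

lemma gdist_eq_Least:
  assumes "graph G" and "Digraph_Component.connected G"
    and "u \<in> verts G" and "v \<in> verts G"
  shows "gdist G u v = real (LEAST n. \<exists>p. pre_digraph.awalk G u p v \<and> length p = n)"
proof -
  interpret graph G by (rule assms(1))
  let ?L = "LEAST n. \<exists>p. awalk u p v \<and> length p = n"
  have "strongly_connected G"
    using symmetric_connected_imp_strongly_connected[OF sym_arcs assms(2)] .
  then have "u \<rightarrow>\<^sup>*\<^bsub>G\<^esub> v"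
    using assms(3,4) by (auto simp: strongly_connected_def)
  then obtain p0 where "awalk u p0 v"
    by (auto simp: reachable_awalk)
  then have "\<exists>n. \<exists>p. awalk u p v \<and> length p = n" by blast
  from LeastI_ex[OF this] obtain p where p: "awalk u p v" "length p = ?L" by blast
  have cost: "awalk_cost (\<lambda>_. 1) q = real (length q)" for q
    by (induction q) (simp_all add: awalk_cost_def)
  have "\<mu> (\<lambda>_. 1) u v = ereal (real ?L)"
  proof (rule antisym)
    show "\<mu> (\<lambda>_. 1) u v \<le> ereal (real ?L)"
      using min_cost_le_walk_cost[OF p(1), of "\<lambda>_. 1"] p(2) by (simp add: cost)
    show "ereal (real ?L) \<le> \<mu> (\<lambda>_. 1) u v"
      unfolding \<mu>_def by (intro INF_greatest) (auto simp: cost intro: Least_le)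
  qed
  then show ?thesis by (simp add: gdist_def)
qed

end

theory Submission
  imports Defs
begin

text \<open>
  Summing over the non-neighbours \<open>v \<noteq> u\<close> of \<open>u\<close>, the bound is
  \<open>\<Sum>u. \<Sum>v. e(u) / 2\<close>.  The matrix vanishes at every other pair, since a distance \<open>\<le> 1\<close> is
  smaller than all eccentricities, and its entry is at most \<open>e(u)\<close> in general.  Equality means
  that every vertex \<open>u\<close> has distance exactly \<open>e(u)\<close> to all its non-neighbours; as a shortest
  path to a farthest vertex passes through a vertex at distance 2, this forces \<open>e(u) = 2\<close>.
\<close>

context
  fixes G :: "('a, 'b) pre_digraph"
  assumes graph: "graph G" and conn: "Digraph_Component.connected G"
begin

interpretation graph G by (rule graph)

lemma gdist_le_length:
  assumes "awalk u p v"
  shows "gdist G u v \<le> real (length p)"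
proof -
  have "u \<in> verts G" "v \<in> verts G" using assms by auto
  then show ?thesis
    using assms by (auto simp: gdist_eq_Least[OF graph conn] intro!: Least_le)
qed

text \<open>Connectedness and symmetry of the arcs make \<open>v\<close> reachable from
  \<open>u\<close>, so the least walk length that defines the distance is attained.\<close>

lemma obtain_shortest_awalk:
  assumes "u \<in> verts G" "v \<in> verts G"
  obtains p where "awalk u p v" "gdist G u v = real (length p)"
proof -
  have "strongly_connected G"
    using symmetric_connected_imp_strongly_connected[OF sym_arcs conn] .
  then have "u \<rightarrow>\<^sup>*\<^bsub>G\<^esub> v" using assms by (auto simp: strongly_connected_def)
  then have "\<exists>n p. awalk u p v \<and> length p = n" by (auto simp: reachable_awalk)
  from LeastI_ex[OF this] that show thesis
    using gdist_eq_Least[OF graph conn assms] by metis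
qed

lemma awalk_one_iff_dominates: "(\<exists>a. awalk u [a] v) \<longleftrightarrow> u \<rightarrow>\<^bsub>G\<^esub> v"
  by (auto simp: awalk_Cons_iff awalk_Nil_iff arcs_ends_conv)

lemma gdist_self [simp]: "u \<in> verts G \<Longrightarrow> gdist G u u = 0"
  using gdist_le_length[of u "[]" u] by (simp add: awalk_Nil_iff gdist_eq_Least[OF graph conn])

lemma gdist_adjacent_le: "u \<rightarrow>\<^bsub>G\<^esub> v \<Longrightarrow> gdist G u v \<le> 1"
  using gdist_le_length[of u "[_]" v] by (auto simp flip: awalk_one_iff_dominates)

lemma gdist_nonadjacent_ge:
  assumes "u \<in> verts G" "v \<in> verts G" "u \<noteq> v" "\<not> u \<rightarrow>\<^bsub>G\<^esub> v"
  shows "2 \<le> gdist G u v"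
proof -
  obtain p where p: "awalk u p v" "gdist G u v = real (length p)"
    using obtain_shortest_awalk assms by blast
  have "2 \<le> length p"
  \<comment> \<open>This rule splits lists into empty, one-element and longer ones: the empty walk
    would give \<open>u = v\<close>, a single arc would make \<open>u\<close> and \<open>v\<close>
    adjacent.\<close>
  proof (cases p rule: remdups_adj.cases)
    case 1
    then show ?thesis using p(1) assms(3) by (simp add: awalk_Nil_iff)
  next
    case (2 a)
    then show ?thesis using p(1) assms(4) awalk_one_iff_dominates by blast
  qed simp
  then show ?thesis using p(2) by simp
qed

text \<open>The witness is the vertex reached after two arcs of a shortest walk from
  \<open>u\<close> to \<open>v\<close>.\<close>

lemma obtain_vertex_at_distance_two:
  assumes "u \<in> verts G" "v \<in> verts G" "2 \<le> gdist G u v"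
  obtains w where "w \<in> verts G" "gdist G u w = 2"
proof -
  obtain p where p: "awalk u p v" "gdist G u v = real (length p)"
    using obtain_shortest_awalk assms by blast
  then have "2 \<le> length p" using assms(3) by simp
  then obtain a b r where r: "p = [a, b] @ r" by (cases p rule: remdups_adj.cases) auto
  then obtain w where w: "awalk u [a, b] w" "awalk w r v"
    using p(1) by (metis awalk_append_iff)
  then have wv: "w \<in> verts G" by auto
  obtain s where s: "awalk u s w" "gdist G u w = real (length s)"
    using obtain_shortest_awalk[OF assms(1) wv] by blast
  \<comment> \<open>Replacing the first two arcs by \<open>s\<close> cannot shorten a shortest walk,
    so \<open>s\<close> has at least two arcs.\<close>
  have "gdist G u v \<le> real (length (s @ r))"
    using s(1) w(2) by (intro gdist_le_length) auto
  then have "2 \<le> gdist G u w" using p(2) r s(2) by simp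
  with gdist_le_length[OF w(1)] wv that show thesis by fastforce
qed

lemma verts_nonempty: "verts G \<noteq> {}"
  using symmetric_connected_imp_strongly_connected[OF sym_arcs conn]
  by (auto simp: strongly_connected_def)

lemma gdist_le_ecc: "v \<in> verts G \<Longrightarrow> gdist G u v \<le> ecc G u"
  by (simp add: ecc_def)

lemma obtain_eccentric_vertex:
  obtains v where "v \<in> verts G" "gdist G u v = ecc G u"
proof -
  have "ecc G u \<in> gdist G u ` verts G"
    unfolding ecc_def using verts_nonempty by (intro Max_in) auto
  then show thesis using that by (metis imageE)
qed

text \<open>The eccentricity is attained as the length of a walk, hence is an integer although typed
  as a real.\<close>

lemma ecc_ge_two:
  assumes "u \<in> verts G" "1 < ecc G u"
  shows "2 \<le> ecc G u"
proof -
  obtain v where v: "v \<in> verts G" "gdist G u v = ecc G u" by (rule obtain_eccentric_vertex)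
  obtain p where p: "awalk u p v" "gdist G u v = real (length p)"
    by (rule obtain_shortest_awalk[OF assms(1) v(1)])
  have "1 < length p" using assms(2) unfolding v(2)[symmetric] p(2) by simp
  then show ?thesis unfolding v(2)[symmetric] p(2) by simp
qed

text \<open>Out-degree counts arcs; without parallel arcs, \<open>head G\<close> maps the arcs
  leaving \<open>u\<close> bijectively onto the neighbours.\<close>

lemma deg_eq_card_neighbours: "deg G u = card {v \<in> verts G. u \<rightarrow>\<^bsub>G\<^esub> v}"
proof -
  have "inj_on (head G) (out_arcs G u)"
    by (intro inj_onI) (auto simp: arc_to_ends_def intro!: no_multi_arcs)
  moreover have "head G ` out_arcs G u = {v \<in> verts G. u \<rightarrow>\<^bsub>G\<^esub> v}"
    by (auto simp: arcs_ends_conv)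
  ultimately show ?thesis by (metis card_image deg_def out_degree_def)
qed

lemma sum_nonneighbours:
  assumes u: "u \<in> verts G"
  shows "(\<Sum>v\<in>verts G. if u \<noteq> v \<and> \<not> u \<rightarrow>\<^bsub>G\<^esub> v then c else 0)
    = (real (card (verts G)) - 1 - real (deg G u)) * c"
proof -
  let ?N = "{v \<in> verts G. u \<rightarrow>\<^bsub>G\<^esub> v}"
  let ?S = "{v \<in> verts G. u \<noteq> v \<and> \<not> u \<rightarrow>\<^bsub>G\<^esub> v}"
  \<comment> \<open>Without loops \<open>u\<close> is not its own neighbour; this accounts for the 1
    in the count of non-neighbours.\<close>
  have "u \<notin> ?N" using no_loops by (auto simp: arcs_ends_conv)
  then have N: "card (insert u ?N) = Suc (deg G u)" by (simp add: deg_eq_card_neighbours)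
  have "card (insert u ?N \<union> ?S) = card (insert u ?N) + card ?S"
    by (rule card_Un_disjoint) auto
  moreover have "insert u ?N \<union> ?S = verts G" using u by auto
  ultimately have "card (verts G) = Suc (deg G u) + card ?S" unfolding N by (simp only:)
  then have S: "real (card ?S) = real (card (verts G)) - 1 - real (deg G u)" by simp
  have "(\<Sum>v\<in>verts G. if u \<noteq> v \<and> \<not> u \<rightarrow>\<^bsub>G\<^esub> v then c else 0) = (\<Sum>v\<in>?S. c)"
    by (rule sum.inter_filter[symmetric]) simp
  then show ?thesis by (simp add: S)
qed

text \<open>Vertex \<open>u\<close> contributes \<open>ecc G u\<close> once per non-neighbour. Over
  all ordered pairs, the bound can be compared with \<open>ecc_wiener\<close> entry by
  entry.\<close>

lemma bound_eq_sum_nonneighbours: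
  "(real (card (verts G)) - 1) * total_ecc G - ecc_connectivity G
    = (\<Sum>u\<in>verts G. \<Sum>v\<in>verts G. if u \<noteq> v \<and> \<not> u \<rightarrow>\<^bsub>G\<^esub> v then ecc G u else 0)"
  by (simp add: sum_nonneighbours total_ecc_def ecc_connectivity_def sum_distrib_left
      sum_subtractf sum.distrib algebra_simps)

context
  assumes ecc_gt_one: "\<And>v. v \<in> verts G \<Longrightarrow> 1 < ecc G v"
begin

lemma ecc_matrix_le:
  assumes "u \<in> verts G" "v \<in> verts G"
  shows "ecc_matrix G u v \<le> (if u \<noteq> v \<and> \<not> u \<rightarrow>\<^bsub>G\<^esub> v then ecc G u else 0)"
proof (cases "u \<noteq> v \<and> \<not> u \<rightarrow>\<^bsub>G\<^esub> v")
  case True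
  then show ?thesis using ecc_gt_one[OF assms(1)] by (auto simp: ecc_matrix_def)
next
  case False
  then have "gdist G u v \<le> 1" using assms gdist_adjacent_le by auto
  then have "gdist G u v < min (ecc G u) (ecc G v)"
    using ecc_gt_one[OF assms(1)] ecc_gt_one[OF assms(2)] by simp
  then show ?thesis using False by (auto simp: ecc_matrix_def min_def)
qed

text \<open>All eccentricities are at least 2, so their maximum is 2 only if all of them
  are.\<close>

lemma diam_eq_two_iff: "diam G = 2 \<longleftrightarrow> (\<forall>u\<in>verts G. ecc G u = 2)"
proof
  assume "diam G = 2"
  then have "ecc G u \<le> 2" if "u \<in> verts G" for u
    using that Max_ge[of "ecc G ` verts G" "ecc G u"] by (simp add: diam_def)
  then show "\<forall>u\<in>verts G. ecc G u = 2" using ecc_ge_two ecc_gt_one by force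
next
  assume "\<forall>u\<in>verts G. ecc G u = 2"
  then have "ecc G ` verts G = {2}" using verts_nonempty by auto
  then show "diam G = 2" by (simp add: diam_def)
qed

lemma ecc_matrix_eq_iff_diam_eq_two:
  "(\<forall>u\<in>verts G. \<forall>v\<in>verts G.
      ecc_matrix G u v = (if u \<noteq> v \<and> \<not> u \<rightarrow>\<^bsub>G\<^esub> v then ecc G u else 0)) \<longleftrightarrow> diam G = 2"
  (is "?E \<longleftrightarrow> _")
proof
  assume E: ?E
  have "ecc G u = 2" if u: "u \<in> verts G" for u
  proof -
    obtain v where "v \<in> verts G" "gdist G u v = ecc G u" by (rule obtain_eccentric_vertex)
    then obtain w where w: "w \<in> verts G" "gdist G u w = 2"
      using obtain_vertex_at_distance_two ecc_ge_two ecc_gt_one u by metis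
    then have "u \<noteq> w \<and> \<not> u \<rightarrow>\<^bsub>G\<^esub> w" using u gdist_adjacent_le by fastforce
    then have "ecc_matrix G u w = ecc G u" using E u w(1) by simp
    \<comment> \<open>The entry equals the positive number \<open>ecc G u\<close>, so it is the
      distance 2 and not the default 0.\<close>
    then show ?thesis using ecc_gt_one[OF u] w(2) by (auto simp: ecc_matrix_def split: if_splits)
  qed
  then show "diam G = 2" by (simp add: diam_eq_two_iff)
next
  assume "diam G = 2"
  then have two: "ecc G u = 2" if "u \<in> verts G" for u using that diam_eq_two_iff by blast
  show ?E
  proof (intro ballI)
    fix u v assume u: "u \<in> verts G" and v: "v \<in> verts G"
    show "ecc_matrix G u v = (if u \<noteq> v \<and> \<not> u \<rightarrow>\<^bsub>G\<^esub> v then ecc G u else 0)"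
    proof (cases "u \<noteq> v \<and> \<not> u \<rightarrow>\<^bsub>G\<^esub> v")
      case True
      \<comment> \<open>Non-adjacency bounds the distance from below by 2, the eccentricity from
        above.\<close>
      then have "gdist G u v = 2"
        using gdist_nonadjacent_ge[OF u v] gdist_le_ecc[OF v, of u] two[OF u] by simp
      then show ?thesis using True two u v by (simp add: ecc_matrix_def)
    next
      case False
      then have "gdist G u v \<le> 1" using u gdist_adjacent_le by auto
      then show ?thesis using False two u v by (auto simp: ecc_matrix_def)
    qed
  qed
qed

end

end

text \<open>Under termwise domination, equal totals force equal row sums, and equal row sums force
  equal entries.\<close>

lemma double_sum_eq_iff:
  fixes f g :: "'a \<Rightarrow> 'b \<Rightarrow> real"
  assumes "finite A" "finite B" and le: "\<And>x y. x \<in> A \<Longrightarrow> y \<in> B \<Longrightarrow> f x y \<le> g x y"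
  shows "(\<Sum>x\<in>A. \<Sum>y\<in>B. f x y) = (\<Sum>x\<in>A. \<Sum>y\<in>B. g x y)
    \<longleftrightarrow> (\<forall>x\<in>A. \<forall>y\<in>B. f x y = g x y)"
proof
  assume eq: "(\<Sum>x\<in>A. \<Sum>y\<in>B. f x y) = (\<Sum>x\<in>A. \<Sum>y\<in>B. g x y)"
  show "\<forall>x\<in>A. \<forall>y\<in>B. f x y = g x y"
  proof (intro ballI)
    fix x y assume x: "x \<in> A" and y: "y \<in> B"
    have "(\<Sum>y\<in>B. f x y) = (\<Sum>y\<in>B. g x y)"
      using sum_mono_inv[OF eq _ x assms(1)] sum_mono le by meson
    from sum_mono_inv[OF this _ y assms(2)] le x show "f x y = g x y" by blast
  qed
qed simp

theorem theorem4p5: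
  fixes G :: "('a, 'b) pre_digraph" and p q :: nat
  assumes "graph G" and "Digraph_Component.connected G"
    and "card (verts G) = p" and "card (uedges G) = q"
    and "\<And>v. v \<in> verts G \<Longrightarrow> ecc G v > 1"
  shows "ecc_wiener G \<le> ((real p - 1) * total_ecc G - ecc_connectivity G) / 2
    \<and> (ecc_wiener G = ((real p - 1) * total_ecc G - ecc_connectivity G) / 2
        \<longleftrightarrow> diam G = 2)"
proof -
  interpret graph G by (rule assms(1))
  note le = ecc_matrix_le[OF assms(1,2,5)]
  note bound = bound_eq_sum_nonneighbours[OF assms(1,2), unfolded assms(3)]
  \<comment> \<open>Both sides are half of a double sum over vertex pairs, so entrywise domination
    gives the inequality and entrywise equality its equality case.\<close>
  show ?thesis
    unfolding bound ecc_wiener_def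
    using sum_mono[OF sum_mono[OF le]] double_sum_eq_iff[OF finite_verts finite_verts le]
      ecc_matrix_eq_iff_diam_eq_two[OF assms(1,2,5)]
    by simp
qed

end
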